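(* Let $X$ be a Banach space, let $E,F\in\mathcal{B}(X)$, and let $M=\begin{pmatrix} E & F \\ F & 0 \end{pmatrix}$, regarded as a bounded linear operator on $X\oplus X$. Suppose that $F$ has a group inverse, that $E$ and $EF^{\pi}$ have Drazin inverses, and that $FEF^{\pi}=0$. Then the following are equivalent: (1) $M$ has a group inverse. (2) $EE^{\pi}F^{\pi}=0$. In this case, $M^{\#}=\begin{pmatrix} \Gamma & \Delta \\ \Lambda & \Xi \end{pmatrix}$, where $$\begin{aligned} \Gamma&=[I-E^{\pi}F^{\pi}][E^DF^{\pi}+E^{\pi}F^{\pi}E(F^{\#})^2]+E^{\pi}F^{\pi}E(F^{\#})^2,\\ \Delta&=[I-E^{\pi}F^{\pi}][F^{\#}-E^{\pi}F^{\pi}E(F^{\#})^2EF^{\#}-E^DF^{\pi}EF^{\#}]-E^{\pi}F^{\pi}E(F^{\#})^2EF^{\#},\\ \Lambda&=F[E^DF^{\pi}+E^{\pi}F^{\pi}E(F^{\#})^2]^2+F^{\#}-FE^{\pi}F^{\pi}[E(F^{\#})^2]^2-FE^DF^{\pi}E(F^{\#})^2,\\ \Xi&=[FE^DF^{\pi}+FE^{\pi}F^{\pi}E(F^{\#})^2][F^{\#}-E^{\pi}F^{\pi}E(F^{\#})^2EF^{\#}-E^DF^{\pi}EF^{\#}]\\ &\quad-[F^{\#}-FE^{\pi}F^{\pi}E(F^{\#})^2E(F^{\#})^2-FE^DF^{\pi}E(F^{\#})^2]EF^{\#}. \end{aligned}$$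
   Context: $\mathcal{B}(X)$ denotes the Banach algebra of bounded linear operators on the Banach space $X$, and $I$ is the identity operator. An operator $T$ has a Drazin inverse if there is a bounded operator $S$ with $ST=TS$, $S=STS$, and $T^n=T^{n+1}S$ for some positive integer $n$; such $S$ is unique and is denoted $T^D$. If these hold with $n=1$ (i.e. $ST=TS$, $S=STS$, $T=T^2S$), then $T$ is said to have a group inverse, and $S$ is denoted $T^{\#}$ (so $T^{\#}=T^D$). If $T$ has a Drazin inverse, $T^{\pi}=I-TT^D$ denotes its spectral idempotent. *)

theory Defs
  imports "HOL-Analysis.Analysis"
begin

text \<open>
  The algebra of bounded operators on a Banach space \<open>X\<close> is the type \<open>'a \<Rightarrow>\<^sub>L 'a\<close> with
  \<open>'a :: banach\<close>. Composition is written as a product, binding tighter than \<open>+\<close> and \<open>-\<close>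
  (unlike \<open>o\<^sub>L\<close>).
\<close>

notation blinfun_compose (infixl "\<cdot>" 70)

primrec blinfun_power ::
    "('a::real_normed_vector \<Rightarrow>\<^sub>L 'a) \<Rightarrow> nat \<Rightarrow> ('a \<Rightarrow>\<^sub>L 'a)" (infixr "^\<^sub>L" 80) where
  "T ^\<^sub>L 0 = id_blinfun"
| "T ^\<^sub>L Suc n = T \<cdot> (T ^\<^sub>L n)"

definition is_drazin_inverse ::
    "('a::real_normed_vector \<Rightarrow>\<^sub>L 'a) \<Rightarrow> ('a \<Rightarrow>\<^sub>L 'a) \<Rightarrow> bool" where
  "is_drazin_inverse T S \<longleftrightarrow>
     S \<cdot> T = T \<cdot> S \<and> S = S \<cdot> T \<cdot> S \<and> (\<exists>n>0. T ^\<^sub>L n = T ^\<^sub>L (n + 1) \<cdot> S)"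

definition is_group_inverse ::
    "('a::real_normed_vector \<Rightarrow>\<^sub>L 'a) \<Rightarrow> ('a \<Rightarrow>\<^sub>L 'a) \<Rightarrow> bool" where
  "is_group_inverse T S \<longleftrightarrow>
     S \<cdot> T = T \<cdot> S \<and> S = S \<cdot> T \<cdot> S \<and> T = T ^\<^sub>L 2 \<cdot> S"

definition has_drazin_inverse :: "('a::real_normed_vector \<Rightarrow>\<^sub>L 'a) \<Rightarrow> bool" where
  "has_drazin_inverse T \<longleftrightarrow> (\<exists>S. is_drazin_inverse T S)"

definition has_group_inverse :: "('a::real_normed_vector \<Rightarrow>\<^sub>L 'a) \<Rightarrow> bool" where
  "has_group_inverse T \<longleftrightarrow> (\<exists>S. is_group_inverse T S)"

text \<open>
  The inverses themselves are meaningful only for operators that have them; uniqueness is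
  proved below.
\<close>

definition drazin_inverse ::
    "('a::real_normed_vector \<Rightarrow>\<^sub>L 'a) \<Rightarrow> ('a \<Rightarrow>\<^sub>L 'a)" ("_\<^sup>D" [1000] 1000) where
  "T\<^sup>D = (THE S. is_drazin_inverse T S)"

definition group_inverse ::
    "('a::real_normed_vector \<Rightarrow>\<^sub>L 'a) \<Rightarrow> ('a \<Rightarrow>\<^sub>L 'a)" ("_\<^sup>#" [1000] 1000) where
  "T\<^sup># = (THE S. is_group_inverse T S)"

definition spectral_idempotent ::
    "('a::real_normed_vector \<Rightarrow>\<^sub>L 'a) \<Rightarrow> ('a \<Rightarrow>\<^sub>L 'a)" ("_\<^sup>\<pi>" [1000] 1000) where
  "T\<^sup>\<pi> = id_blinfun - T \<cdot> T\<^sup>D"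

lift_definition block_operator ::
    "('a::real_normed_vector \<Rightarrow>\<^sub>L 'a) \<Rightarrow> ('a \<Rightarrow>\<^sub>L 'a) \<Rightarrow> ('a \<Rightarrow>\<^sub>L 'a) \<Rightarrow> ('a \<Rightarrow>\<^sub>L 'a)
       \<Rightarrow> ('a \<times> 'a) \<Rightarrow>\<^sub>L ('a \<times> 'a)" is
  "\<lambda>A B C D (x, y). (A x + B y, C x + D y)"
  unfolding case_prod_unfold
  by (intro bounded_linear_Pair bounded_linear_add
      bounded_linear_compose[OF _ bounded_linear_fst]
      bounded_linear_compose[OF _ bounded_linear_snd])

lemma block_operator_apply:
  "block_operator A B C D (x, y) = (A x + B y, C x + D y)"
  by transfer simp

lemma blinfun_power_1: "T ^\<^sub>L 1 = T"
  by (simp add: One_nat_def blinfun_eqI)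

lemma blinfun_power_2: "T ^\<^sub>L 2 = T \<cdot> T"
  by (simp add: numeral_2_eq_2 blinfun_eqI)

lemma blinfun_power_apply: "blinfun_apply (T ^\<^sub>L n) = (blinfun_apply T ^^ n)"
  by (induction n) auto

lemma is_group_inverse_imp_is_drazin_inverse:
  assumes "is_group_inverse T S"
  shows "is_drazin_inverse T S"
  using assms blinfun_power_1[of T] unfolding is_group_inverse_def is_drazin_inverse_def
  by (metis less_one one_add_one)

lemma is_drazin_inverse_pointwise:
  assumes "is_drazin_inverse T S"
  shows "S (T x) = T (S x)" and "S (T (S x)) = S x"
    and "\<exists>n. \<forall>k\<ge>n. \<forall>x. (blinfun_apply T ^^ k) (T (S x)) = (blinfun_apply T ^^ k) x"
proof -
  have comm: "S \<cdot> T = T \<cdot> S" and refl: "S = S \<cdot> T \<cdot> S"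
    using assms by (auto simp: is_drazin_inverse_def)
  show "S (T x) = T (S x)"
    using arg_cong[OF comm, of "\<lambda>f. blinfun_apply f x"] by simp
  show "S (T (S x)) = S x"
    using arg_cong[OF refl, of "\<lambda>f. blinfun_apply f x"] by simp
  obtain n where n: "T ^\<^sub>L n = T ^\<^sub>L (n + 1) \<cdot> S"
    using assms by (auto simp: is_drazin_inverse_def)
  have base: "(blinfun_apply T ^^ n) (T (S x)) = (blinfun_apply T ^^ n) x" for x
    using arg_cong[OF n, of "\<lambda>f. blinfun_apply f x"]
    by (simp add: blinfun_power_apply funpow_swap1)
  have "(blinfun_apply T ^^ k) (T (S x)) = (blinfun_apply T ^^ k) x" if "k \<ge> n" for k x
    using that by (induction k rule: dec_induct) (simp_all add: base)
  then show "\<exists>n. \<forall>k\<ge>n. \<forall>x. (blinfun_apply T ^^ k) (T (S x)) = (blinfun_apply T ^^ k) x"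
    by blast
qed

lemma is_drazin_inverse_unique:
  assumes S: "is_drazin_inverse T S" and S': "is_drazin_inverse T S'"
  shows "S = S'"
proof -
  note c = is_drazin_inverse_pointwise(1)[OF S] and c' = is_drazin_inverse_pointwise(1)[OF S']
  note i = is_drazin_inverse_pointwise(2)[OF S] and i' = is_drazin_inverse_pointwise(2)[OF S']
  obtain n where n: "\<And>k x. k \<ge> n \<Longrightarrow> (blinfun_apply T ^^ k) (T (S x)) = (blinfun_apply T ^^ k) x"
    using is_drazin_inverse_pointwise(3)[OF S] by blast
  obtain n' where n': "\<And>k x. k \<ge> n' \<Longrightarrow> (blinfun_apply T ^^ k) (T (S' x)) = (blinfun_apply T ^^ k) x"
    using is_drazin_inverse_pointwise(3)[OF S'] by blast
  define k where "k = max n n'"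
  have pow: "T (R x) = (blinfun_apply R ^^ Suc j) ((blinfun_apply T ^^ Suc j) x)"
    if R: "is_drazin_inverse T R" for R j x
  proof (induction j arbitrary: x)
    case 0
    then show ?case
      using is_drazin_inverse_pointwise(1)[OF R] by simp
  next
    case (Suc j)
    have "(blinfun_apply R ^^ Suc (Suc j)) ((blinfun_apply T ^^ Suc (Suc j)) x)
        = R ((blinfun_apply R ^^ Suc j) ((blinfun_apply T ^^ Suc j) (T x)))"
      by (simp add: funpow_swap1)
    also have "\<dots> = R (T (R (T x)))"
      by (simp only: Suc.IH[symmetric])
    also have "\<dots> = T (R x)"
      using is_drazin_inverse_pointwise(1,2)[OF R] by simp
    finally show ?case by simp
  qed
  have comm: "R ((blinfun_apply T ^^ j) x) = (blinfun_apply T ^^ j) (R x)"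
    if "is_drazin_inverse T R" for R j x
    using is_drazin_inverse_pointwise(1)[OF that] by (induction j) simp_all
  have comm2: "(blinfun_apply R ^^ i) ((blinfun_apply T ^^ j) x) = (blinfun_apply T ^^ j) ((blinfun_apply R ^^ i) x)"
    if "is_drazin_inverse T R" for R i j x
    using comm[OF that] by (induction i) simp_all
  have a: "T (S x) = T (S (T (S' x)))" for x
    using pow[OF S, of x k] pow[OF S, of "T (S' x)" k] n'[of "Suc k" x]
    by (simp add: k_def)
  have b: "T (S' x) = T (S (T (S' x)))" for x
  proof -
    let ?y = "(blinfun_apply S' ^^ Suc k) x"
    have y: "T (S' x) = (blinfun_apply T ^^ Suc k) ?y"
      by (simp only: pow[OF S', of x k] comm2[OF S'])
    have "T (S ((blinfun_apply T ^^ Suc k) ?y)) = (blinfun_apply T ^^ Suc k) (T (S ?y))"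
      by (simp only: comm[OF S] funpow_swap1)
    also have "\<dots> = (blinfun_apply T ^^ Suc k) ?y"
      by (rule n) (simp add: k_def)
    finally show ?thesis
      by (simp only: y)
  qed
  have p: "T (S x) = T (S' x)" for x
    using a b by simp
  show ?thesis
  proof (rule blinfun_eqI)
    fix x
    have "S x = S (T (S' x))"
      by (simp only: p[symmetric] i)
    also have "\<dots> = S' (T (S' x))"
      by (simp only: c c' p)
    finally show "S x = S' x"
      by (simp only: i')
  qed
qed

lemma drazin_inverse_eq: "is_drazin_inverse T S \<Longrightarrow> T\<^sup>D = S"
  unfolding drazin_inverse_def by (blast intro: the_equality is_drazin_inverse_unique)

lemma group_inverse_eq: "is_group_inverse T S \<Longrightarrow> T\<^sup># = S"
  unfolding group_inverse_def
  by (blast intro: the_equality is_drazin_inverse_unique is_group_inverse_imp_is_drazin_inverse)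

lemma group_inverse_eq_drazin_inverse: "has_group_inverse T \<Longrightarrow> T\<^sup># = T\<^sup>D"
  by (metis has_group_inverse_def group_inverse_eq drazin_inverse_eq
      is_group_inverse_imp_is_drazin_inverse)

end

theory Submission
  imports Defs
begin

text \<open>
  Along \<open>X = ran F \<oplus> ker F\<close> the hypothesis \<open>F E F\<^sup>\<pi> = 0\<close> makes \<open>E\<close> block triangular; let \<open>B\<close> be
  its compression to \<open>ker F\<close>, represented by \<open>E F\<^sup>\<pi>\<close>. Since \<open>F\<close> is invertible on its range, \<open>M\<close> is,
  up to a zero summand, block triangular with one invertible diagonal block and the other equal
  to \<open>B\<close>. So \<open>M\<close> has a group inverse iff \<open>B\<close> has one, that is \<open>B B\<^sup>\<pi> = 0\<close>. To relate this to \<open>E\<^sup>D\<close> we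
  use that Drazin inverses respect intertwining: \<open>A J = J B\<close> implies \<open>A\<^sup>D J = J B\<^sup>D\<close>. This gives
  \<open>E\<^sup>D F\<^sup>\<pi> = F\<^sup>\<pi> (E F\<^sup>\<pi>)\<^sup>D\<close>, and it transports the group inverse of \<open>M\<close> to \<open>ker F\<close>.
\<close>

text \<open>\<open>S\<close> commutes with \<open>T\<close> and \<open>S T S = S\<close>, so each
  \<open>T\<close> absorbs one surplus \<open>S\<close>. Hence \<open>S\<close> can be rewritten
  with an arbitrarily high power of \<open>T\<close>, to which the power identity of a Drazin
  inverse applies.\<close>

lemma is_drazin_inverse_power_cancel:
  assumes "is_drazin_inverse T S"
  shows "(blinfun_apply S ^^ Suc j) ((blinfun_apply T ^^ j) x) = S x"
proof (induction j arbitrary: x)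
  case (Suc j)
  have "(blinfun_apply S ^^ Suc (Suc j)) ((blinfun_apply T ^^ Suc j) x)
      = S ((blinfun_apply S ^^ Suc j) ((blinfun_apply T ^^ j) (T x)))"
    by (simp add: funpow_swap1)
  also have "\<dots> = S (S (T x))"
    by (simp only: Suc)
  also have "\<dots> = S x"
    by (metis is_drazin_inverse_pointwise(1,2)[OF assms])
  finally show ?case .
qed simp

text \<open>Both sides equal \<open>D A J S = D J B S\<close>, since \<open>J\<close> carries powers
  of \<open>B\<close> to powers of \<open>A\<close>. Domain and codomain of \<open>J\<close> may
  differ, which allows embeddings of \<open>X\<close> into \<open>X \<times> X\<close>.\<close>

lemma drazin_inverse_intertwine:
  fixes A :: "'b::real_normed_vector \<Rightarrow>\<^sub>L 'b" and B :: "'a::real_normed_vector \<Rightarrow>\<^sub>L 'a"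
    and J :: "'a \<Rightarrow>\<^sub>L 'b"
  assumes D: "is_drazin_inverse A D" and S: "is_drazin_inverse B S"
    and AJ: "A \<cdot> J = J \<cdot> B"
  shows "D \<cdot> J = J \<cdot> S"
proof (rule blinfun_eqI)
  fix x
  have "A (J y) = J (B y)" for y
    using AJ by (metis blinfun_apply_blinfun_compose)
  then have pow: "(blinfun_apply A ^^ j) (J y) = J ((blinfun_apply B ^^ j) y)" for j y
    by (induction j) simp_all
  obtain n where n: "\<And>k x. k \<ge> n \<Longrightarrow> (blinfun_apply A ^^ k) (A (D x)) = (blinfun_apply A ^^ k) x"
    using is_drazin_inverse_pointwise(3)[OF D] by blast
  obtain m where m: "\<And>k x. k \<ge> m \<Longrightarrow> (blinfun_apply B ^^ k) (B (S x)) = (blinfun_apply B ^^ k) x"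
    using is_drazin_inverse_pointwise(3)[OF S] by blast
  \<comment> \<open>This exponent is past both indices, so \<open>A\<close> and \<open>B\<close>
    satisfy their power identities at once.\<close>
  define k where "k = max n m"
  have comm: "(blinfun_apply T ^^ j) (R y) = R ((blinfun_apply T ^^ j) y)"
    if "is_drazin_inverse T R" for T R :: "'c::real_normed_vector \<Rightarrow>\<^sub>L 'c" and j y
    using is_drazin_inverse_pointwise(1)[OF that] by (induction j) simp_all
  have S_pow: "S y = (blinfun_apply B ^^ k) ((blinfun_apply S ^^ Suc k) y)" for y
  proof -
    have "(blinfun_apply S ^^ j) ((blinfun_apply B ^^ k) y)
        = (blinfun_apply B ^^ k) ((blinfun_apply S ^^ j) y)" for j
      by (induction j) (simp_all add: comm[OF S])
    then show ?thesis
      by (metis is_drazin_inverse_power_cancel[OF S])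
  qed
  have "D (J x) = (blinfun_apply D ^^ Suc k) (J ((blinfun_apply B ^^ k) x))"
    using is_drazin_inverse_power_cancel[OF D, of k "J x"] by (simp only: pow)
  also have "\<dots> = (blinfun_apply D ^^ Suc k) (J ((blinfun_apply B ^^ k) (B (S x))))"
    using m[of k x] by (simp add: k_def)
  also have "\<dots> = D (J (B (S x)))"
    using is_drazin_inverse_power_cancel[OF D, of k "J (B (S x))"] by (simp only: pow)
  also have "\<dots> = D (A (J (S x)))"
    by (simp only: \<open>\<And>y. A (J y) = J (B y)\<close>)
  \<comment> \<open>Now from the right: \<open>S_pow\<close> puts \<open>B^k\<close> behind
    \<open>J\<close>, where it turns into an \<open>A^k\<close> that absorbs
    \<open>A D\<close>.\<close>
  also have "\<dots> = A (D ((blinfun_apply A ^^ k) (J ((blinfun_apply S ^^ Suc k) x))))"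
    by (simp only: is_drazin_inverse_pointwise(1)[OF D] pow S_pow[symmetric])
  also have "\<dots> = (blinfun_apply A ^^ k) (A (D (J ((blinfun_apply S ^^ Suc k) x))))"
    by (simp only: comm[OF D, symmetric] funpow_swap1)
  also have "\<dots> = J (S x)"
    using n[of k] by (simp only: k_def max.cobounded1 pow[folded k_def] S_pow[symmetric, unfolded k_def])
  finally show "(D \<cdot> J) x = (J \<cdot> S) x"
    by simp
qed

text \<open>Oriented as rewrite rules: mixed products of \<open>F\<close> and
  \<open>F\<^sup>#\<close> are traded for the projection \<open>F\<^sup>\<pi>\<close> onto
  \<open>ker F\<close>, which both annihilate.\<close>

lemma group_inverse_pointwise:
  assumes "has_group_inverse F"
  shows "F (F\<^sup># x) = x - F\<^sup>\<pi> x" and "F\<^sup># (F x) = x - F\<^sup>\<pi> x"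
    and "F (F\<^sup>\<pi> x) = 0" and "F\<^sup>\<pi> (F x) = 0"
    and "F\<^sup># (F\<^sup>\<pi> x) = 0" and "F\<^sup>\<pi> (F\<^sup># x) = 0" and "F\<^sup>\<pi> (F\<^sup>\<pi> x) = F\<^sup>\<pi> x"
proof -
  have "is_group_inverse F (F\<^sup>#)"
    using assms group_inverse_eq unfolding has_group_inverse_def by blast
  then have g: "F\<^sup># (F y) = F (F\<^sup># y)" "F (F\<^sup># (F\<^sup># y)) = F\<^sup># y" "F (F (F\<^sup># y)) = F y" for y
    unfolding is_group_inverse_def blinfun_power_2
    by (metis blinfun_apply_blinfun_compose)+
  have p: "F\<^sup>\<pi> y = y - F (F\<^sup># y)" for y
    by (simp add: spectral_idempotent_def group_inverse_eq_drazin_inverse[OF assms]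
        blinfun.diff_left)
  show "F (F\<^sup># x) = x - F\<^sup>\<pi> x" "F\<^sup># (F x) = x - F\<^sup>\<pi> x" "F (F\<^sup>\<pi> x) = 0" "F\<^sup>\<pi> (F x) = 0"
    "F\<^sup># (F\<^sup>\<pi> x) = 0" "F\<^sup>\<pi> (F\<^sup># x) = 0" "F\<^sup>\<pi> (F\<^sup>\<pi> x) = F\<^sup>\<pi> x"
    by (simp_all add: p g blinfun.diff_right)
qed

text \<open>\<open>F E F\<^sup>\<pi> = 0\<close> says that \<open>E\<close> preserves
  \<open>ker F\<close>, so \<open>F\<^sup>\<pi>\<close> itself intertwines \<open>E\<close> with
  \<open>E F\<^sup>\<pi>\<close>. Intertwining of the Drazin inverses then shows that
  \<open>E\<^sup>D\<close> preserves \<open>ker F\<close> too.\<close>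

lemma drazin_inverse_compression:
  assumes F: "has_group_inverse F" and E: "has_drazin_inverse E"
    and EF: "has_drazin_inverse (E \<cdot> F\<^sup>\<pi>)" and FEF: "F \<cdot> E \<cdot> F\<^sup>\<pi> = 0"
  shows "F\<^sup>\<pi> (E (F\<^sup>\<pi> x)) = E (F\<^sup>\<pi> x)"
    and "is_drazin_inverse (E \<cdot> F\<^sup>\<pi>) S \<Longrightarrow> E\<^sup>D \<cdot> F\<^sup>\<pi> = F\<^sup>\<pi> \<cdot> S"
    and "F\<^sup>\<pi> (E\<^sup>D (F\<^sup>\<pi> x)) = E\<^sup>D (F\<^sup>\<pi> x)"
proof -
  note g = group_inverse_pointwise[OF F]
  have *: "F (E (F\<^sup>\<pi> y)) = 0" for y
    using FEF by (metis blinfun_apply_blinfun_compose zero_blinfun.rep_eq)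
  show inv: "F\<^sup>\<pi> (E (F\<^sup>\<pi> y)) = E (F\<^sup>\<pi> y)" for y
    using g(2)[of "E (F\<^sup>\<pi> y)"] by (simp add: *)
  have "is_drazin_inverse E (E\<^sup>D)"
    using E drazin_inverse_eq unfolding has_drazin_inverse_def by blast
  moreover have "E \<cdot> F\<^sup>\<pi> = F\<^sup>\<pi> \<cdot> (E \<cdot> F\<^sup>\<pi>)"
    by (rule blinfun_eqI) (simp add: inv)
  ultimately show DS: "E\<^sup>D \<cdot> F\<^sup>\<pi> = F\<^sup>\<pi> \<cdot> S" if "is_drazin_inverse (E \<cdot> F\<^sup>\<pi>) S" for S
    using drazin_inverse_intertwine that by blast
  obtain S where "is_drazin_inverse (E \<cdot> F\<^sup>\<pi>) S"
    using EF unfolding has_drazin_inverse_def by blast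
  then have "E\<^sup>D (F\<^sup>\<pi> x) = F\<^sup>\<pi> (S x)"
    using DS by (metis blinfun_apply_blinfun_compose)
  then show "F\<^sup>\<pi> (E\<^sup>D (F\<^sup>\<pi> x)) = E\<^sup>D (F\<^sup>\<pi> x)"
    by (simp add: g)
qed

text \<open>\<open>E\<close> and \<open>E\<^sup>D\<close> preserve \<open>ker F\<close>. The longer
  words in them are listed separately because the rules for a single factor do not match once a
  second factor stands before \<open>F\<^sup>\<pi>\<close>.\<close>

lemma compression_simps:
  assumes F: "has_group_inverse F" and E: "has_drazin_inverse E"
    and EF: "has_drazin_inverse (E \<cdot> F\<^sup>\<pi>)" and FEF: "F \<cdot> E \<cdot> F\<^sup>\<pi> = 0"
  shows "E\<^sup>D (E x) = E (E\<^sup>D x)" and "E (E\<^sup>D (E\<^sup>D x)) = E\<^sup>D x"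
    and "E\<^sup>\<pi> x = x - E (E\<^sup>D x)"
    and "F\<^sup>\<pi> (E (F\<^sup>\<pi> x)) = E (F\<^sup>\<pi> x)"
    and "F\<^sup>\<pi> (E\<^sup>D (F\<^sup>\<pi> x)) = E\<^sup>D (F\<^sup>\<pi> x)"
    and "F\<^sup>\<pi> (E (E\<^sup>D (F\<^sup>\<pi> x))) = E (E\<^sup>D (F\<^sup>\<pi> x))"
    and "F\<^sup>\<pi> (E\<^sup>D (E\<^sup>D (F\<^sup>\<pi> x))) = E\<^sup>D (E\<^sup>D (F\<^sup>\<pi> x))"
    and "F (E (F\<^sup>\<pi> x)) = 0" and "F (E\<^sup>D (F\<^sup>\<pi> x)) = 0"
    and "F (E (E\<^sup>D (F\<^sup>\<pi> x))) = 0" and "F (E\<^sup>D (E\<^sup>D (F\<^sup>\<pi> x))) = 0"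
    and "F\<^sup># (E (F\<^sup>\<pi> x)) = 0" and "F\<^sup># (E\<^sup>D (F\<^sup>\<pi> x)) = 0"
    and "F\<^sup># (E (E\<^sup>D (F\<^sup>\<pi> x))) = 0"
proof -
  note g = group_inverse_pointwise(3,5)[OF F]
  note c = drazin_inverse_compression(1,3)[OF F E EF FEF]
  have "is_drazin_inverse E (E\<^sup>D)"
    using E drazin_inverse_eq unfolding has_drazin_inverse_def by blast
  from is_drazin_inverse_pointwise(1,2)[OF this]
  show "E\<^sup>D (E x) = E (E\<^sup>D x)" "E (E\<^sup>D (E\<^sup>D x)) = E\<^sup>D x"
    by simp_all
  show "E\<^sup>\<pi> x = x - E (E\<^sup>D x)"
    by (simp add: spectral_idempotent_def blinfun.diff_left)
  show q: "F\<^sup>\<pi> (E (F\<^sup>\<pi> x)) = E (F\<^sup>\<pi> x)" "F\<^sup>\<pi> (E\<^sup>D (F\<^sup>\<pi> x)) = E\<^sup>D (F\<^sup>\<pi> x)"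
    "F\<^sup>\<pi> (E (E\<^sup>D (F\<^sup>\<pi> x))) = E (E\<^sup>D (F\<^sup>\<pi> x))"
    "F\<^sup>\<pi> (E\<^sup>D (E\<^sup>D (F\<^sup>\<pi> x))) = E\<^sup>D (E\<^sup>D (F\<^sup>\<pi> x))"
    by (metis c)+
  show "F (E (F\<^sup>\<pi> x)) = 0" "F (E\<^sup>D (F\<^sup>\<pi> x)) = 0"
    "F (E (E\<^sup>D (F\<^sup>\<pi> x))) = 0" "F (E\<^sup>D (E\<^sup>D (F\<^sup>\<pi> x))) = 0"
    "F\<^sup># (E (F\<^sup>\<pi> x)) = 0" "F\<^sup># (E\<^sup>D (F\<^sup>\<pi> x)) = 0"
    "F\<^sup># (E (E\<^sup>D (F\<^sup>\<pi> x))) = 0"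
    by (metis q g)+
qed

text \<open>The candidate is the claimed formula after cancellation; the three axioms are checked by
  evaluating at a pair of vectors.\<close>

lemma block_operator_is_group_inverse:
  assumes F: "has_group_inverse F" and E: "has_drazin_inverse E"
    and EF: "has_drazin_inverse (E \<cdot> F\<^sup>\<pi>)" and FEF: "F \<cdot> E \<cdot> F\<^sup>\<pi> = 0"
    and EE: "E \<cdot> E\<^sup>\<pi> \<cdot> F\<^sup>\<pi> = 0"
  shows "is_group_inverse (block_operator E F F 0)
    (block_operator
      (E\<^sup>D \<cdot> F\<^sup>\<pi> + E\<^sup>\<pi> \<cdot> F\<^sup>\<pi> \<cdot> E \<cdot> (F\<^sup># ^\<^sub>L 2))
      (F\<^sup># - E\<^sup>D \<cdot> F\<^sup>\<pi> \<cdot> E \<cdot> F\<^sup># - E\<^sup>\<pi> \<cdot> F\<^sup>\<pi> \<cdot> E \<cdot> (F\<^sup># ^\<^sub>L 2) \<cdot> E \<cdot> F\<^sup>#)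
      (F\<^sup>#)
      (- (F\<^sup># \<cdot> E \<cdot> F\<^sup>#)))" (is "is_group_inverse ?M ?G")
proof -
  note c = compression_simps[OF F E EF FEF]
  have "(E \<cdot> E\<^sup>\<pi> \<cdot> F\<^sup>\<pi>) y = 0" for y
    using EE by simp
  \<comment> \<open>On \<open>ker F\<close> the hypothesis reads \<open>E E E\<^sup>D = E\<close>,
    that is, the compression of \<open>E\<close> has index at most one.\<close>
  then have "E (E (E\<^sup>D (F\<^sup>\<pi> y))) = E (F\<^sup>\<pi> y)" for y
    by (simp add: c(3) blinfun.diff_right)
  note simps = block_operator_apply blinfun_power_2 blinfun.add_left blinfun.diff_left
    blinfun.add_right blinfun.diff_right blinfun.minus_left blinfun.minus_right
    group_inverse_pointwise[OF F] c this
  have "?G \<cdot> ?M = ?M \<cdot> ?G"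
    by (rule blinfun_eqI) (auto simp: simps)
  moreover have "?G = ?G \<cdot> ?M \<cdot> ?G"
    by (rule blinfun_eqI) (auto simp: simps)
  moreover have "?M = (?M ^\<^sub>L 2) \<cdot> ?G"
    by (rule blinfun_eqI) (auto simp: simps)
  ultimately show ?thesis
    unfolding is_group_inverse_def by blast
qed

text \<open>\<open>M\<close> sends \<open>(v, 0)\<close> with \<open>v\<close> in
  \<open>ker F\<close> to \<open>(E v, 0)\<close>, so it contains the compression of
  \<open>E\<close> as a restriction. Intertwining carries \<open>M = M M G\<close> over to
  it.\<close>

lemma block_operator_group_inverse_imp:
  assumes F: "has_group_inverse F" and E: "has_drazin_inverse E"
    and EF: "has_drazin_inverse (E \<cdot> F\<^sup>\<pi>)" and FEF: "F \<cdot> E \<cdot> F\<^sup>\<pi> = 0"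
    and M: "has_group_inverse (block_operator E F F 0)"
  shows "E \<cdot> E\<^sup>\<pi> \<cdot> F\<^sup>\<pi> = 0"
proof -
  let ?M = "block_operator E F F 0"
  note g = group_inverse_pointwise[OF F]
  note c = drazin_inverse_compression[OF F E EF FEF]
  obtain S where S: "is_drazin_inverse (E \<cdot> F\<^sup>\<pi>) S"
    using EF unfolding has_drazin_inverse_def by blast
  obtain G where G: "is_group_inverse ?M G"
    using M unfolding has_group_inverse_def by blast
  define J where "J = Blinfun (\<lambda>x. (F\<^sup>\<pi> x, 0 :: 'a))"
  have J: "J x = (F\<^sup>\<pi> x, 0)" for x
    unfolding J_def
    by (subst bounded_linear_Blinfun_apply) (auto intro!: bounded_linear_Pair blinfun.bounded_linear_right)
  have MJ: "?M \<cdot> J = J \<cdot> (E \<cdot> F\<^sup>\<pi>)"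
    by (rule blinfun_eqI) (simp add: J block_operator_apply g c)
  have GJ: "G \<cdot> J = J \<cdot> S"
    using drazin_inverse_intertwine[OF is_group_inverse_imp_is_drazin_inverse[OF G] S MJ] .
  have DS: "F\<^sup>\<pi> (S x) = E\<^sup>D (F\<^sup>\<pi> x)" for x
    using c(2)[OF S] by (metis blinfun_apply_blinfun_compose)
  have "E (F\<^sup>\<pi> x) = E (E (E\<^sup>D (F\<^sup>\<pi> x)))" for x
  proof -
    have "?M = ?M \<cdot> ?M \<cdot> G"
      using G by (simp add: is_group_inverse_def blinfun_power_2)
    then have "?M (J x) = ?M (?M (G (J x)))"
      by (metis blinfun_apply_blinfun_compose)
    also have "G (J x) = J (S x)"
      using GJ by (metis blinfun_apply_blinfun_compose)
    \<comment> \<open>First coordinates give the claim. By \<open>DS\<close>, the instance of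
      \<open>g(3)\<close> becomes \<open>F E\<^sup>D F\<^sup>\<pi> = 0\<close> at \<open>x\<close>,
      which clears the second coordinate of \<open>M J S x\<close> before \<open>M\<close> acts
      again.\<close>
    finally show ?thesis
      using g(3)[of "S x"] by (simp add: J block_operator_apply DS)
  qed
  then show ?thesis
    by (intro blinfun_eqI)
      (simp add: spectral_idempotent_def[of E] blinfun.diff_left blinfun.diff_right)
qed

theorem theorem3p1:
  fixes E F :: "'a::banach \<Rightarrow>\<^sub>L 'a"
  assumes "has_group_inverse F"
    and "has_drazin_inverse E"
    and "has_drazin_inverse (E \<cdot> F\<^sup>\<pi>)"
    and "F \<cdot> E \<cdot> F\<^sup>\<pi> = 0"
  shows "(has_group_inverse (block_operator E F F 0) \<longleftrightarrow> E \<cdot> E\<^sup>\<pi> \<cdot> F\<^sup>\<pi> = 0) \<and>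
    (has_group_inverse (block_operator E F F 0) \<longrightarrow>
      (block_operator E F F 0)\<^sup># =
      block_operator
        ((id_blinfun - E\<^sup>\<pi> \<cdot> F\<^sup>\<pi>) \<cdot> (E\<^sup>D \<cdot> F\<^sup>\<pi> + E\<^sup>\<pi> \<cdot> F\<^sup>\<pi> \<cdot> E \<cdot> (F\<^sup># ^\<^sub>L 2))
          + E\<^sup>\<pi> \<cdot> F\<^sup>\<pi> \<cdot> E \<cdot> (F\<^sup># ^\<^sub>L 2))
        ((id_blinfun - E\<^sup>\<pi> \<cdot> F\<^sup>\<pi>) \<cdot>
            (F\<^sup># - E\<^sup>\<pi> \<cdot> F\<^sup>\<pi> \<cdot> E \<cdot> (F\<^sup># ^\<^sub>L 2) \<cdot> E \<cdot> F\<^sup># - E\<^sup>D \<cdot> F\<^sup>\<pi> \<cdot> E \<cdot> F\<^sup>#)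
          - E\<^sup>\<pi> \<cdot> F\<^sup>\<pi> \<cdot> E \<cdot> (F\<^sup># ^\<^sub>L 2) \<cdot> E \<cdot> F\<^sup>#)
        (F \<cdot> ((E\<^sup>D \<cdot> F\<^sup>\<pi> + E\<^sup>\<pi> \<cdot> F\<^sup>\<pi> \<cdot> E \<cdot> (F\<^sup># ^\<^sub>L 2)) ^\<^sub>L 2)
          + F\<^sup>#
          - F \<cdot> E\<^sup>\<pi> \<cdot> F\<^sup>\<pi> \<cdot> ((E \<cdot> (F\<^sup># ^\<^sub>L 2)) ^\<^sub>L 2)
          - F \<cdot> E\<^sup>D \<cdot> F\<^sup>\<pi> \<cdot> E \<cdot> (F\<^sup># ^\<^sub>L 2))
        ((F \<cdot> E\<^sup>D \<cdot> F\<^sup>\<pi> + F \<cdot> E\<^sup>\<pi> \<cdot> F\<^sup>\<pi> \<cdot> E \<cdot> (F\<^sup># ^\<^sub>L 2)) \<cdot>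
            (F\<^sup># - E\<^sup>\<pi> \<cdot> F\<^sup>\<pi> \<cdot> E \<cdot> (F\<^sup># ^\<^sub>L 2) \<cdot> E \<cdot> F\<^sup># - E\<^sup>D \<cdot> F\<^sup>\<pi> \<cdot> E \<cdot> F\<^sup>#)
          - (F\<^sup># - F \<cdot> E\<^sup>\<pi> \<cdot> F\<^sup>\<pi> \<cdot> E \<cdot> (F\<^sup># ^\<^sub>L 2) \<cdot> E \<cdot> (F\<^sup># ^\<^sub>L 2)
              - F \<cdot> E\<^sup>D \<cdot> F\<^sup>\<pi> \<cdot> E \<cdot> (F\<^sup># ^\<^sub>L 2)) \<cdot> E \<cdot> F\<^sup>#))"
    (is "(_ \<longleftrightarrow> _) \<and> (_ \<longrightarrow> _ = ?G)")
proof -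
  note simps = blinfun_power_2 blinfun.add_left blinfun.diff_left blinfun.minus_left
    blinfun.add_right blinfun.diff_right group_inverse_pointwise[OF assms(1)]
    compression_simps[OF assms]
  \<comment> \<open>No condition on \<open>E E\<^sup>\<pi> F\<^sup>\<pi>\<close> enters here:
    \<open>F\<close> kills \<open>E\<^sup>D F\<^sup>\<pi>\<close> and
    \<open>E\<^sup>\<pi> F\<^sup>\<pi>\<close>, which collapses the lower row, while
    \<open>E\<^sup>\<pi> F\<^sup>\<pi>\<close> is idempotent and annihilates
    \<open>E\<^sup>D F\<^sup>\<pi>\<close> and \<open>F\<^sup>#\<close>, which shortens the upper
    row.\<close>
  have "?G = block_operator
        (E\<^sup>D \<cdot> F\<^sup>\<pi> + E\<^sup>\<pi> \<cdot> F\<^sup>\<pi> \<cdot> E \<cdot> (F\<^sup># ^\<^sub>L 2))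
        (F\<^sup># - E\<^sup>D \<cdot> F\<^sup>\<pi> \<cdot> E \<cdot> F\<^sup># - E\<^sup>\<pi> \<cdot> F\<^sup>\<pi> \<cdot> E \<cdot> (F\<^sup># ^\<^sub>L 2) \<cdot> E \<cdot> F\<^sup>#)
        (F\<^sup>#)
        (- (F\<^sup># \<cdot> E \<cdot> F\<^sup>#))"
    by (intro arg_cong4[where f = block_operator] blinfun_eqI) (simp_all add: simps)
  then have "is_group_inverse (block_operator E F F 0) ?G" if "E \<cdot> E\<^sup>\<pi> \<cdot> F\<^sup>\<pi> = 0"
    using block_operator_is_group_inverse[OF assms that] by simp
  then show ?thesis
    using block_operator_group_inverse_imp[OF assms] group_inverse_eq
    unfolding has_group_inverse_def by blast
qed

end
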